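(* Let $(\Omega,\Sigma,\mu)$ be a non-atomic probability space and let $X$ be a real or complex Banach space. Let $f\in S(L^1(\mu,X))$ be such that $\tilde{S}_f$ is a non-empty weakly compact subset of $L^\infty(\mu,X^* )$. Then $\tilde{S}_f$ is a singleton.
   Context: For a Banach space $E$, $S(E)$ is its unit sphere and $E_1$ its closed unit ball. $L^1(\mu,X)$ is the space of (classes of) $X$-valued Bochner integrable functions with norm $\|f\|=\int_\Omega\|f(\omega)\|\,d\mu(\omega)$. $L^\infty(\mu,X^* )$ is the space of (classes of) $X^*$-valued strongly measurable, essentially bounded functions with the essential supremum norm. For $f\in S(L^1(\mu,X))$, $\tilde{S}_f=\{g\in L^\infty(\mu,X^* )_1: \int_\Omega g(\omega)(f(\omega))\,d\mu(\omega)=1\}$ (this set may be empty in general). *)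

theory Defs
  imports "HOL-Probability.Probability"
begin

text \<open>
  The scalar field: up to isomorphism, the instances of this class are exactly the real and the
  complex numbers, so that a statement about all its instances is a statement about real
  and complex scalars.
\<close>

class real_or_complex = real_normed_field + euclidean_space +
  assumes range_of_real_or_imaginary_unit:
    "(\<forall>z. \<exists>a. z = a *\<^sub>R 1) \<or>
     (\<exists>i. i * i = - 1 \<and> (\<forall>z. \<exists>a b. z = a *\<^sub>R 1 + b *\<^sub>R i))"

instance real :: real_or_complex
  by standard auto

instance complex :: real_or_complex
proof
  have "z = Re z *\<^sub>R 1 + Im z *\<^sub>R \<i>" for z :: complex
    by (simp add: complex_eq_iff)
  then show "(\<forall>z::complex. \<exists>a. z = a *\<^sub>R 1) \<or>
     (\<exists>i::complex. i * i = - 1 \<and> (\<forall>z. \<exists>a b. z = a *\<^sub>R 1 + b *\<^sub>R i))"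
    by (intro disjI2 exI[of _ \<i>] conjI allI) (simp, blast)
qed

text \<open>
  The library's class \<open>banach\<close> only provides real scalars; the scalar multiplication by \<open>'k\<close>
  is an explicit parameter. For \<open>'k = real\<close> it is forced to be \<open>scaleR\<close>.
\<close>

locale banach_over = vector_space smul
  for smul :: "'k::real_or_complex \<Rightarrow> 'x::banach \<Rightarrow> 'x" +
  assumes scale_of_real: "smul (of_real r) x = r *\<^sub>R x"
    and norm_scale: "norm (smul c x) = norm c * norm x"

lemma banach_over_real: "banach_over (scaleR :: real \<Rightarrow> 'x::banach \<Rightarrow> 'x)"
  by unfold_locales (auto simp: algebra_simps)

lemma banach_over_complex: "banach_over ((*) :: complex \<Rightarrow> complex \<Rightarrow> complex)"
  by unfold_locales (auto simp: algebra_simps scaleR_conv_of_real norm_mult)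

text \<open>
  The dual space: the \<open>'k\<close>-linear ones among the bounded real-linear maps into \<open>'k\<close>. The norm of
  the type \<open>'x \<Rightarrow>\<^sub>L 'k\<close> restricts to the usual dual norm.
\<close>

definition dual_space :: "('k::real_or_complex \<Rightarrow> 'x::banach \<Rightarrow> 'x) \<Rightarrow> ('x \<Rightarrow>\<^sub>L 'k) set" where
  "dual_space smul =
    {\<phi>. \<forall>c x. blinfun_apply \<phi> (smul c x) = c * blinfun_apply \<phi> x}"

definition dual_scale :: "'k::real_or_complex \<Rightarrow> ('x::banach \<Rightarrow>\<^sub>L 'k) \<Rightarrow> ('x \<Rightarrow>\<^sub>L 'k)" where
  "dual_scale c \<phi> = blinfun_mult_right c o\<^sub>L \<phi>"

lemma dual_scale_apply [simp]:
  "blinfun_apply (dual_scale c \<phi>) x = c * blinfun_apply \<phi> x"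
  by (simp add: dual_scale_def)

definition non_atomic :: "'w measure \<Rightarrow> bool" where
  "non_atomic M \<longleftrightarrow>
    (\<forall>A\<in>sets M. emeasure M A > 0 \<longrightarrow>
      (\<exists>B\<in>sets M. B \<subseteq> A \<and> 0 < emeasure M B \<and> emeasure M B < emeasure M A))"

text \<open>
  The library's Bochner integrability for functions with values in a Banach space requires that
  space to be second countable, so the vector-valued notions are defined here. Strong measurability
  is required everywhere on the space rather than almost everywhere; as functions are only
  considered up to equality almost everywhere, this gives the same spaces of classes.
\<close>

definition strongly_measurable_into ::
    "'v::real_normed_vector set \<Rightarrow> 'w measure \<Rightarrow> ('w \<Rightarrow> 'v) \<Rightarrow> bool" where
  "strongly_measurable_into E M f \<longleftrightarrow>
    f \<in> space M \<rightarrow> E \<and>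
    (\<exists>s. (\<forall>i::nat. simple_function M (s i) \<and> s i \<in> space M \<rightarrow> E) \<and>
      (\<forall>\<omega>\<in>space M. (\<lambda>i. s i \<omega>) \<longlonglongrightarrow> f \<omega>))"

definition bochner_integrable :: "'w measure \<Rightarrow> ('w \<Rightarrow> 'x::banach) \<Rightarrow> bool" where
  "bochner_integrable M f \<longleftrightarrow>
    strongly_measurable_into UNIV M f \<and>
    (\<exists>s. (\<forall>i::nat. simple_function M (s i) \<and> emeasure M {\<omega>\<in>space M. s i \<omega> \<noteq> 0} < \<infinity>) \<and>
      (\<lambda>i. \<integral>\<^sup>+\<omega>. ennreal (norm (f \<omega> - s i \<omega>)) \<partial>M) \<longlonglongrightarrow> 0)"

text \<open>Functions here, not classes: what follows depends on them only up to equality a.e.\<close>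

definition L1_sphere :: "'w measure \<Rightarrow> ('w \<Rightarrow> 'x::banach) set" where
  "L1_sphere M = {f. bochner_integrable M f \<and> (\<integral>\<omega>. norm (f \<omega>) \<partial>M) = 1}"

text \<open>\<open>Linf_fun\<close> consists of functions, \<open>Linf\<close> of their classes modulo equality almost everywhere.\<close>

definition Linf_fun ::
    "('k::real_or_complex \<Rightarrow> 'x::banach \<Rightarrow> 'x) \<Rightarrow> 'w measure \<Rightarrow> ('w \<Rightarrow> 'x \<Rightarrow>\<^sub>L 'k) set" where
  "Linf_fun smul M =
    {g. strongly_measurable_into (dual_space smul) M g \<and>
        esssup M (\<lambda>\<omega>. ereal (norm (g \<omega>))) < \<infinity>}"

definition Linf_norm :: "'w measure \<Rightarrow> ('w \<Rightarrow> 'v::real_normed_vector) \<Rightarrow> real" where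
  "Linf_norm M g = real_of_ereal (esssup M (\<lambda>\<omega>. ereal (norm (g \<omega>))))"

definition Linf_rel ::
    "('k::real_or_complex \<Rightarrow> 'x::banach \<Rightarrow> 'x) \<Rightarrow> 'w measure \<Rightarrow>
      (('w \<Rightarrow> 'x \<Rightarrow>\<^sub>L 'k) \<times> ('w \<Rightarrow> 'x \<Rightarrow>\<^sub>L 'k)) set" where
  "Linf_rel smul M =
    {(g, h). g \<in> Linf_fun smul M \<and> h \<in> Linf_fun smul M \<and> (AE \<omega> in M. g \<omega> = h \<omega>)}"

lemma equiv_Linf_rel: "equiv (Linf_fun smul M) (Linf_rel smul M)"
proof (rule equivI)
  show "Linf_rel smul M \<subseteq> Linf_fun smul M \<times> Linf_fun smul M"
    by (auto simp: Linf_rel_def)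
  show "refl_on (Linf_fun smul M) (Linf_rel smul M)"
    by (auto simp: refl_on_def Linf_rel_def)
  show "sym (Linf_rel smul M)"
    by (auto simp: sym_def Linf_rel_def)
  show "trans (Linf_rel smul M)"
    unfolding trans_def Linf_rel_def by auto
qed

abbreviation Linf_class ::
    "('k::real_or_complex \<Rightarrow> 'x::banach \<Rightarrow> 'x) \<Rightarrow> 'w measure \<Rightarrow>
      ('w \<Rightarrow> 'x \<Rightarrow>\<^sub>L 'k) \<Rightarrow> ('w \<Rightarrow> 'x \<Rightarrow>\<^sub>L 'k) set" where
  "Linf_class smul M g \<equiv> Linf_rel smul M `` {g}"

definition Linf ::
    "('k::real_or_complex \<Rightarrow> 'x::banach \<Rightarrow> 'x) \<Rightarrow> 'w measure \<Rightarrow> ('w \<Rightarrow> 'x \<Rightarrow>\<^sub>L 'k) set set" where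
  "Linf smul M = Linf_fun smul M // Linf_rel smul M"

text \<open>
  The bounded linear functionals on the space of classes, its vector space structure and norm being
  induced by representatives. The values of a functional outside \<open>Linf\<close> are irrelevant.
\<close>

definition Linf_functionals ::
    "('k::real_or_complex \<Rightarrow> 'x::banach \<Rightarrow> 'x) \<Rightarrow> 'w measure \<Rightarrow>
      (('w \<Rightarrow> 'x \<Rightarrow>\<^sub>L 'k) set \<Rightarrow> 'k) set" where
  "Linf_functionals smul M =
    {\<Phi>. (\<forall>g\<in>Linf_fun smul M. \<forall>h\<in>Linf_fun smul M.
            \<Phi> (Linf_class smul M (\<lambda>\<omega>. g \<omega> + h \<omega>)) =
            \<Phi> (Linf_class smul M g) + \<Phi> (Linf_class smul M h)) \<and>
         (\<forall>c. \<forall>g\<in>Linf_fun smul M.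
            \<Phi> (Linf_class smul M (\<lambda>\<omega>. dual_scale c (g \<omega>))) = c * \<Phi> (Linf_class smul M g)) \<and>
         (\<exists>C. \<forall>g\<in>Linf_fun smul M.
            norm (\<Phi> (Linf_class smul M g)) \<le> C * Linf_norm M g)}"

definition Linf_weak_topology ::
    "('k::real_or_complex \<Rightarrow> 'x::banach \<Rightarrow> 'x) \<Rightarrow> 'w measure \<Rightarrow>
      ('w \<Rightarrow> 'x \<Rightarrow>\<^sub>L 'k) set topology" where
  "Linf_weak_topology smul M =
    topology_generated_by
      {{G \<in> Linf smul M. \<Phi> G \<in> U} |\<Phi> U. \<Phi> \<in> Linf_functionals smul M \<and> open U}"

lemma topspace_Linf_weak_topology: "topspace (Linf_weak_topology smul M) = Linf smul M"
proof -
  have "(\<lambda>_. 0) \<in> Linf_functionals smul M"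
    by (auto simp: Linf_functionals_def intro: exI[of _ 0])
  then have "\<exists>\<Phi> U. Linf smul M = {G \<in> Linf smul M. \<Phi> G \<in> U} \<and>
      \<Phi> \<in> Linf_functionals smul M \<and> open U"
    by (intro exI[of _ "\<lambda>_. 0"] exI[of _ UNIV]) auto
  then show ?thesis
    unfolding Linf_weak_topology_def topology_generated_by_topspace by blast
qed

definition S_tilde ::
    "('k::real_or_complex \<Rightarrow> 'x::banach \<Rightarrow> 'x) \<Rightarrow> 'w measure \<Rightarrow> ('w \<Rightarrow> 'x) \<Rightarrow>
      ('w \<Rightarrow> 'x \<Rightarrow>\<^sub>L 'k) set set" where
  "S_tilde smul M f =
    {Linf_class smul M g |g. g \<in> Linf_fun smul M \<and> Linf_norm M g \<le> 1 \<and>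
       (\<integral>\<omega>. blinfun_apply (g \<omega>) (f \<omega>) \<partial>M) = 1}"

end

theory Submission
  imports Defs
begin

text \<open>
  If \<open>g\<close> belongs to \<open>S_tilde smul M f\<close>, then \<open>g \<omega> (f \<omega>)\<close> is almost everywhere at most \<open>norm (f \<omega>)\<close>
  in absolute value, while both have integral 1; so they agree almost everywhere. Membership is therefore a pointwise
  condition, and two members \<open>g\<close> and \<open>h\<close> can be glued along any measurable set
  (\<open>S_tilde_glue\<close>). If \<open>g\<close> and \<open>h\<close> are not equal almost everywhere, gluing along the many sets
  that a non-atomic measure offers produces a copy of the indicator functions in
  \<open>L\<^sup>\<infinity>\<close>, which is not relatively weakly compact.

  To make this explicit, strong measurability provides a vector \<open>x\<close>, a scalar \<open>c \<noteq> 0\<close> and a set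
  of positive measure on which \<open>(g \<omega> - h \<omega>) x\<close> stays within \<open>norm c / 2\<close> of \<open>c\<close>
  (\<open>exists_concentrated_values\<close>). Inside that set there is a decreasing sequence of sets \<open>D n\<close>
  whose successive differences \<open>R i = D i - D (Suc i)\<close> have positive measure. Let \<open>u n\<close> be \<open>h\<close> on
  \<open>D n\<close> and \<open>g\<close> elsewhere, and let \<open>\<phi> i\<close> be the functional averaging \<open>v \<omega> x\<close> over \<open>R i\<close>. Then
  \<open>\<phi> i\<close> has the same value at \<open>u n\<close> as at \<open>g\<close> if \<open>i < n\<close>, and as at \<open>h\<close> otherwise. The \<open>\<phi> i\<close> are
  uniformly bounded and converge pointwise along a free ultrafilter to a bounded functional \<open>\<Phi>\<close>,
  with \<open>\<Phi> (u n) = \<Phi> h\<close> for every \<open>n\<close>, but \<open>\<Phi> g \<noteq> \<Phi> h\<close>.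

  The weakly open sets \<open>{G. \<phi> i G \<noteq> \<phi> i g}\<close> and \<open>{G. \<Phi> G \<noteq> \<Phi> h}\<close> cover \<open>S_tilde smul M f\<close>:
  a \<open>G\<close> outside all of the former satisfies \<open>\<Phi> G = \<Phi> g\<close>. But finitely many of them
  miss \<open>u n\<close> for large \<open>n\<close>, so that the set is not weakly compact. The averages alone would
  not suffice, since each of them has the same value at \<open>u n\<close> as at \<open>g\<close> for large \<open>n\<close>.
\<close>

section \<open>Limits along a free ultrafilter\<close>

text \<open>
  The ultrafilter lemma: a minimal proper filter is an ultrafilter. Zorn's lemma applies to the
  reversed order because the infimum of a chain of proper filters consists of exactly the properties
  that hold eventually for some member, hence is proper.
\<close>

lemma exists_minimal_proper_filter_below:
  fixes F :: "'a filter"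
  assumes "F \<noteq> bot"
  shows "\<exists>U. U \<noteq> bot \<and> U \<le> F \<and> (\<forall>V. V \<noteq> bot \<longrightarrow> V \<le> U \<longrightarrow> V = U)"
proof -
  let ?A = "{U. U \<noteq> bot \<and> U \<le> F}"
  have "\<exists>u\<in>?A. \<forall>a\<in>C. a \<ge> u" if C: "C \<in> Chains (relation_of (\<ge>) ?A)" for C
  proof (cases "C = {}")
    case True
    then show ?thesis using assms by blast
  next
    case False
    have "C \<subseteq> ?A" and chain: "\<And>a b. a \<in> C \<Longrightarrow> b \<in> C \<Longrightarrow> a \<ge> b \<or> b \<ge> a"
      using C by (auto simp: Chains_def relation_of_def)
    have "eventually P (Inf C) \<longleftrightarrow> (\<exists>b\<in>C. eventually P b)" for P
    proof (rule eventually_Inf_base[OF False])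
      fix a b assume "a \<in> C" "b \<in> C"
      then show "\<exists>x\<in>C. x \<le> inf a b" using chain[of a b] by (metis inf.absorb1 inf.absorb2 order_refl)
    qed
    then have "Inf C \<noteq> bot"
      using \<open>C \<subseteq> ?A\<close> by (auto simp: trivial_limit_def)
    moreover have "Inf C \<le> F"
    proof -
      obtain b where "b \<in> C" using False by blast
      then show ?thesis using Inf_lower2[of b C F] \<open>C \<subseteq> ?A\<close> by auto
    qed
    ultimately show ?thesis by (intro bexI[of _ "Inf C"]) (auto intro: Inf_lower)
  qed
  moreover have "partial_order_on ?A (relation_of (\<ge>) ?A)"
    by (rule partial_order_on_relation_ofI) auto
  ultimately obtain m where "m \<in> ?A" "\<forall>a\<in>?A. m \<ge> a \<longrightarrow> a = m"
    using predicate_Zorn[of ?A "(\<ge>)"] by blast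
  then show ?thesis by (intro exI[of _ m]) (auto dest: order_trans)
qed

text \<open>
  Compactness gives a cluster point of the sequence along the ultrafilter, and minimality turns every
  cluster point into a limit. One filter serves all bounded sequences, which is what makes the limit
  linear.
\<close>

lemma exists_free_ultralimit:
  "\<exists>U. U \<noteq> bot \<and> U \<le> sequentially \<and>
    (\<forall>s :: nat \<Rightarrow> 'k::heine_borel. bounded (range s) \<longrightarrow> (\<exists>l. (s \<longlongrightarrow> l) U))"
proof -
  obtain U :: "nat filter" where "U \<noteq> bot" "U \<le> sequentially"
    and min: "\<And>V. V \<noteq> bot \<Longrightarrow> V \<le> U \<Longrightarrow> V = U"
    using exists_minimal_proper_filter_below[OF sequentially_bot] by blast
  have "\<exists>l. (s \<longlongrightarrow> l) U" if "bounded (range s)" for s :: "nat \<Rightarrow> 'k"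
  proof -
    have "compact (closure (range s))" using that by (simp add: compact_closure)
    moreover have "filtermap s U \<noteq> bot" using \<open>U \<noteq> bot\<close> by (simp add: filtermap_bot_iff)
    moreover have "eventually (\<lambda>x. x \<in> closure (range s)) (filtermap s U)"
      by (simp add: eventually_filtermap closure_subset[THEN subsetD])
    ultimately obtain l where l: "inf (nhds l) (filtermap s U) \<noteq> bot"
      unfolding compact_filter by blast
    have "eventually (\<lambda>n. s n \<in> S) U" if "open S" "l \<in> S" for S
    proof -
      let ?V = "inf U (principal {n. s n \<in> S})"
      have "?V \<noteq> bot"
      proof
        assume "?V = bot"
        then have "eventually (\<lambda>n. s n \<notin> S) U"
          by (simp add: trivial_limit_def eventually_inf_principal)
        then have "eventually (\<lambda>y. y \<notin> S) (filtermap s U)"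
          by (simp add: eventually_filtermap)
        moreover have "eventually (\<lambda>y. y \<in> S) (nhds l)"
          using that by (rule eventually_nhds_in_open)
        ultimately have "eventually (\<lambda>y. False) (inf (nhds l) (filtermap s U))"
          by (auto simp: eventually_inf)
        with l show False by (simp add: trivial_limit_def)
      qed
      then have "?V = U" by (intro min) auto
      then have "eventually (\<lambda>n. s n \<in> S) U \<longleftrightarrow> eventually (\<lambda>n. s n \<in> S) ?V"
        by (rule arg_cong[where f = "eventually _", symmetric])
      then show ?thesis by (simp add: eventually_inf_principal)
    qed
    then have "(s \<longlongrightarrow> l) U" by (rule topological_tendstoI)
    then show ?thesis ..
  qed
  with \<open>U \<noteq> bot\<close> \<open>U \<le> sequentially\<close> show ?thesis by blast
qed

section \<open>Strongly measurable functions and the space of essentially bounded ones\<close>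

lemma strongly_measurable_into_map2:
  assumes g: "strongly_measurable_into E M g" and h: "strongly_measurable_into E' M h"
    and F: "\<And>u v. u \<in> E \<Longrightarrow> v \<in> E' \<Longrightarrow> F u v \<in> E''"
    and cont: "continuous_on UNIV (\<lambda>(u, v). F u v)"
  shows "strongly_measurable_into E'' M (\<lambda>\<omega>. F (g \<omega>) (h \<omega>))"
proof -
  obtain s t where s: "\<And>i::nat. simple_function M (s i)" "\<And>i. s i \<in> space M \<rightarrow> E"
      "\<And>\<omega>. \<omega> \<in> space M \<Longrightarrow> (\<lambda>i. s i \<omega>) \<longlonglongrightarrow> g \<omega>"
    and t: "\<And>i::nat. simple_function M (t i)" "\<And>i. t i \<in> space M \<rightarrow> E'"
      "\<And>\<omega>. \<omega> \<in> space M \<Longrightarrow> (\<lambda>i. t i \<omega>) \<longlonglongrightarrow> h \<omega>"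
    using g h unfolding strongly_measurable_into_def by blast
  have "(\<lambda>i. F (s i \<omega>) (t i \<omega>)) \<longlonglongrightarrow> F (g \<omega>) (h \<omega>)" if "\<omega> \<in> space M" for \<omega>
    using continuous_on_tendsto_compose[OF cont tendsto_Pair[OF s(3)[OF that] t(3)[OF that]]]
    by simp
  moreover have "(\<lambda>\<omega>. F (s i \<omega>) (t i \<omega>)) \<in> space M \<rightarrow> E''" for i
    using s(2)[of i] t(2)[of i] F by blast
  moreover have "(\<lambda>\<omega>. F (g \<omega>) (h \<omega>)) \<in> space M \<rightarrow> E''"
    using g h F unfolding strongly_measurable_into_def by blast
  ultimately show ?thesis
    unfolding strongly_measurable_into_def
    using simple_function_compose2[OF s(1) t(1), of F]
    by (intro conjI exI[of _ "\<lambda>i \<omega>. F (s i \<omega>) (t i \<omega>)"]) auto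
qed

lemma strongly_measurable_into_If:
  assumes g: "strongly_measurable_into E M g" and h: "strongly_measurable_into E M h"
    and B: "B \<in> sets M"
  shows "strongly_measurable_into E M (\<lambda>\<omega>. if \<omega> \<in> B then g \<omega> else h \<omega>)"
proof -
  obtain s t where s: "\<And>i::nat. simple_function M (s i)" "\<And>i. s i \<in> space M \<rightarrow> E"
      "\<And>\<omega>. \<omega> \<in> space M \<Longrightarrow> (\<lambda>i. s i \<omega>) \<longlonglongrightarrow> g \<omega>"
    and t: "\<And>i::nat. simple_function M (t i)" "\<And>i. t i \<in> space M \<rightarrow> E"
      "\<And>\<omega>. \<omega> \<in> space M \<Longrightarrow> (\<lambda>i. t i \<omega>) \<longlonglongrightarrow> h \<omega>"
    using g h unfolding strongly_measurable_into_def by blast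
  have "simple_function M (\<lambda>\<omega>. if \<omega> \<in> B then s i \<omega> else t i \<omega>)" for i
    using s(1) t(1) B by (intro simple_function_If_set) auto
  moreover have "(\<lambda>\<omega>. if \<omega> \<in> B then s i \<omega> else t i \<omega>) \<in> space M \<rightarrow> E" for i
    using s(2)[of i] t(2)[of i] by auto
  moreover have "(\<lambda>\<omega>. if \<omega> \<in> B then g \<omega> else h \<omega>) \<in> space M \<rightarrow> E"
    using g h unfolding strongly_measurable_into_def by auto
  ultimately show ?thesis
    unfolding strongly_measurable_into_def using s(3) t(3)
    by (intro conjI exI[of _ "\<lambda>i \<omega>. if \<omega> \<in> B then s i \<omega> else t i \<omega>"]) auto
qed

lemma strongly_measurable_into_compose_continuous:
  fixes F :: "'v::real_normed_vector \<Rightarrow> 'b::metric_space"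
  assumes g: "strongly_measurable_into E M g" and cont: "continuous_on UNIV F"
  shows "(\<lambda>\<omega>. F (g \<omega>)) \<in> borel_measurable M"
proof -
  obtain s where s: "\<And>i::nat. simple_function M (s i)"
      "\<And>\<omega>. \<omega> \<in> space M \<Longrightarrow> (\<lambda>i. s i \<omega>) \<longlonglongrightarrow> g \<omega>"
    using g unfolding strongly_measurable_into_def by blast
  show ?thesis
  proof (rule borel_measurable_LIMSEQ_metric)
    show "(\<lambda>\<omega>. F (s i \<omega>)) \<in> borel_measurable M" for i
      using simple_function_compose1[OF s(1), of F] by (rule borel_measurable_simple_function)
    show "(\<lambda>i. F (s i \<omega>)) \<longlonglongrightarrow> F (g \<omega>)" if "\<omega> \<in> space M" for \<omega>
      using continuous_on_tendsto_compose[OF cont s(2)[OF that]] by simp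
  qed
qed

lemma strongly_measurable_into_apply_measurable:
  fixes g :: "'w \<Rightarrow> 'x::real_normed_vector \<Rightarrow>\<^sub>L 'k::real_normed_vector"
  assumes "strongly_measurable_into E M g"
  shows "(\<lambda>\<omega>. blinfun_apply (g \<omega>) x) \<in> borel_measurable M"
  by (rule strongly_measurable_into_compose_continuous[OF assms, of "\<lambda>\<phi>. blinfun_apply \<phi> x"])
    (intro continuous_intros)

lemma Linf_fun_iff_AE_bounded:
  "g \<in> Linf_fun smul M \<longleftrightarrow>
    strongly_measurable_into (dual_space smul) M g \<and> (\<exists>C. AE \<omega> in M. norm (g \<omega>) \<le> C)"
proof (cases "strongly_measurable_into (dual_space smul) M g")
  case True
  have meas: "(\<lambda>\<omega>. ereal (norm (g \<omega>))) \<in> borel_measurable M"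
    using strongly_measurable_into_compose_continuous[OF True continuous_on_norm_id]
    by simp
  have "\<exists>C. AE \<omega> in M. norm (g \<omega>) \<le> C" if "esssup M (\<lambda>\<omega>. ereal (norm (g \<omega>))) < \<infinity>"
    using esssup_AE[of "\<lambda>\<omega>. ereal (norm (g \<omega>))" M] that
    by (cases "esssup M (\<lambda>\<omega>. ereal (norm (g \<omega>)))") auto
  moreover have "esssup M (\<lambda>\<omega>. ereal (norm (g \<omega>))) < \<infinity>" if "AE \<omega> in M. norm (g \<omega>) \<le> C" for C
    using esssup_I[OF meas, of "ereal C"] that by (auto intro: le_less_trans)
  ultimately show ?thesis using True by (auto simp: Linf_fun_def)
qed (simp add: Linf_fun_def)

lemma AE_norm_le_Linf_norm:
  assumes "g \<in> Linf_fun smul M"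
  shows "AE \<omega> in M. norm (g \<omega>) \<le> Linf_norm M g"
  using esssup_AE[of "\<lambda>\<omega>. ereal (norm (g \<omega>))" M] assms
  unfolding Linf_norm_def Linf_fun_def
  by (cases "esssup M (\<lambda>\<omega>. ereal (norm (g \<omega>)))") auto

lemma Linf_norm_le:
  assumes g: "strongly_measurable_into E M g" and le: "AE \<omega> in M. norm (g \<omega>) \<le> C" and "0 \<le> C"
  shows "Linf_norm M g \<le> C"
proof -
  have meas: "(\<lambda>\<omega>. ereal (norm (g \<omega>))) \<in> borel_measurable M"
    using strongly_measurable_into_compose_continuous[OF g continuous_on_norm_id]
    by simp
  have "esssup M (\<lambda>\<omega>. ereal (norm (g \<omega>))) \<le> ereal C"
    using esssup_I[OF meas, of "ereal C"] le by auto
  with \<open>0 \<le> C\<close> show ?thesis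
    unfolding Linf_norm_def by (cases "esssup M (\<lambda>\<omega>. ereal (norm (g \<omega>)))") auto
qed

lemma Linf_fun_add:
  fixes smul :: "'k::real_or_complex \<Rightarrow> 'x::banach \<Rightarrow> 'x"
  assumes g: "g \<in> Linf_fun smul M" and h: "h \<in> Linf_fun smul M"
  shows "(\<lambda>\<omega>. g \<omega> + h \<omega>) \<in> Linf_fun smul M"
proof -
  have "AE \<omega> in M. norm (g \<omega> + h \<omega>) \<le> Linf_norm M g + Linf_norm M h"
    using AE_norm_le_Linf_norm[OF g] AE_norm_le_Linf_norm[OF h]
    by eventually_elim (metis norm_triangle_mono)
  moreover have "strongly_measurable_into (dual_space smul) M (\<lambda>\<omega>. g \<omega> + h \<omega>)"
  proof (rule strongly_measurable_into_map2[where F = "(+)"])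
    show "strongly_measurable_into (dual_space smul) M g" "strongly_measurable_into (dual_space smul) M h"
      using g h by (simp_all add: Linf_fun_def)
    show "u + v \<in> dual_space smul" if "u \<in> dual_space smul" "v \<in> dual_space smul" for u v
      using that by (simp add: dual_space_def blinfun.add_left distrib_left)
    show "continuous_on UNIV (\<lambda>(u::'x \<Rightarrow>\<^sub>L 'k, v). u + v)"
      unfolding split_def by (intro continuous_intros)
  qed
  ultimately show ?thesis unfolding Linf_fun_iff_AE_bounded by blast
qed

lemma Linf_fun_dual_scale:
  fixes smul :: "'k::real_or_complex \<Rightarrow> 'x::banach \<Rightarrow> 'x"
  assumes g: "g \<in> Linf_fun smul M"
  shows "(\<lambda>\<omega>. dual_scale c (g \<omega>)) \<in> Linf_fun smul M"
proof -
  have le: "norm (dual_scale c \<phi>) \<le> norm c * norm \<phi>" for \<phi> :: "'x \<Rightarrow>\<^sub>L 'k"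
    by (rule norm_blinfun_bound) (auto simp: norm_mult norm_blinfun mult.assoc mult_left_mono)
  have "AE \<omega> in M. norm (dual_scale c (g \<omega>)) \<le> norm c * Linf_norm M g"
    using AE_norm_le_Linf_norm[OF g]
    by eventually_elim (rule order_trans[OF le mult_left_mono], simp_all)
  moreover have "strongly_measurable_into (dual_space smul) M (\<lambda>\<omega>. dual_scale c (g \<omega>))"
  proof (rule strongly_measurable_into_map2[where F = "\<lambda>u _. dual_scale c u"])
    show "strongly_measurable_into (dual_space smul) M g" "strongly_measurable_into (dual_space smul) M g"
      using g by (simp_all add: Linf_fun_def)
    show "dual_scale c u \<in> dual_space smul" if "u \<in> dual_space smul" for u
      using that by (simp add: dual_space_def mult.left_commute)
    show "continuous_on UNIV (\<lambda>(u::'x \<Rightarrow>\<^sub>L 'k, _::'x \<Rightarrow>\<^sub>L 'k). dual_scale c u)"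
      unfolding split_def dual_scale_def by (intro continuous_intros)
  qed
  ultimately show ?thesis unfolding Linf_fun_iff_AE_bounded by blast
qed

lemma Linf_class_eq_iff:
  assumes "g \<in> Linf_fun smul M" "h \<in> Linf_fun smul M"
  shows "Linf_class smul M g = Linf_class smul M h \<longleftrightarrow> (AE \<omega> in M. g \<omega> = h \<omega>)"
  using eq_equiv_class_iff[OF equiv_Linf_rel assms] assms by (auto simp: Linf_rel_def)

section \<open>Averages as functionals\<close>

definition mean_apply ::
    "'w measure \<Rightarrow> 'w set \<Rightarrow> 'x::banach \<Rightarrow> ('w \<Rightarrow> 'x \<Rightarrow>\<^sub>L 'k::real_or_complex) \<Rightarrow> 'k" where
  "mean_apply M A x u = (LINT \<omega>:A|M. blinfun_apply (u \<omega>) x) /\<^sub>R measure M A"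

text \<open>
  Functionals act on classes, so the average is evaluated at an arbitrary representative.
\<close>

definition class_mean_apply ::
    "'w measure \<Rightarrow> 'w set \<Rightarrow> 'x::banach \<Rightarrow> ('w \<Rightarrow> 'x \<Rightarrow>\<^sub>L 'k::real_or_complex) set \<Rightarrow> 'k" where
  "class_mean_apply M A x G = mean_apply M A x (SOME u. u \<in> G)"

lemma class_mean_apply_Linf_class:
  assumes u: "u \<in> Linf_fun smul M" and A: "A \<in> sets M"
  shows "class_mean_apply M A x (Linf_class smul M u) = mean_apply M A x u"
proof -
  define v where "v = (SOME v. v \<in> Linf_class smul M u)"
  have "u \<in> Linf_class smul M u"
    using u by (auto simp: Linf_rel_def)
  then have "v \<in> Linf_class smul M u"
    unfolding v_def by (rule someI[where P = "\<lambda>v. v \<in> Linf_class smul M u"])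
  then have v: "v \<in> Linf_fun smul M" and ae: "AE \<omega> in M. u \<omega> = v \<omega>"
    by (auto simp: Linf_rel_def)
  have [measurable]: "(\<lambda>\<omega>. blinfun_apply (u \<omega>) x) \<in> borel_measurable M"
      "(\<lambda>\<omega>. blinfun_apply (v \<omega>) x) \<in> borel_measurable M"
    using u v strongly_measurable_into_apply_measurable by (auto simp: Linf_fun_def)
  have "(LINT \<omega>:A|M. blinfun_apply (v \<omega>) x) = (LINT \<omega>:A|M. blinfun_apply (u \<omega>) x)"
    unfolding set_lebesgue_integral_def using ae A
    by (intro integral_cong_AE) auto
  then show ?thesis
    by (simp add: class_mean_apply_def mean_apply_def v_def)
qed

text \<open>
  An average lies in every closed ball that contains the averaged values. Used with centre 0 to bound
  the averaging functionals, and with centre \<open>c\<close> to keep their values away from 0.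
\<close>

lemma norm_set_average_diff_le:
  fixes v :: "'w \<Rightarrow> 'k::{banach, second_countable_topology}"
  assumes v: "set_integrable M A v" and A: "A \<in> sets M" "0 < measure M A"
    and le: "AE \<omega>\<in>A in M. norm (v \<omega> - c) \<le> r"
  shows "norm ((LINT \<omega>:A|M. v \<omega>) /\<^sub>R measure M A - c) \<le> r"
proof -
  have fin: "emeasure M A \<noteq> \<infinity>"
    using A(2) by (auto simp: measure_def)
  then have const: "set_integrable M A (\<lambda>_. c)" "set_integrable M A (\<lambda>_. r)"
    using A(1) by (simp_all add: set_integrable_def less_top)
  have "norm ((LINT \<omega>:A|M. v \<omega>) - measure M A *\<^sub>R c) = norm (LINT \<omega>:A|M. v \<omega> - c)"
    by (simp add: set_integral_diff(2)[OF v const(1)] set_integral_const[OF A(1) fin])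
  also have "\<dots> \<le> (LINT \<omega>:A|M. norm (v \<omega> - c))"
    using v const by (intro set_integral_norm_bound set_integral_diff)
  also have "\<dots> \<le> (LINT \<omega>:A|M. r)"
    using v const le
    by (intro set_integral_mono_AE set_integrable_norm set_integral_diff) auto
  also have "\<dots> = measure M A * r"
    using A(1) fin by (simp add: set_integral_const)
  finally have le': "norm ((LINT \<omega>:A|M. v \<omega>) - measure M A *\<^sub>R c) \<le> measure M A * r" .
  have "norm (y /\<^sub>R measure M A) \<le> r" if "norm y \<le> measure M A * r" for y :: 'k
    using that A(2) by (simp add: field_simps)
  from this[OF le'] show ?thesis
    using A(2) by (simp add: scaleR_diff_right)
qed

lemma Linf_fun_apply_set_integrable:
  assumes "prob_space M" and u: "u \<in> Linf_fun smul M" and A: "A \<in> sets M"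
  shows "set_integrable M A (\<lambda>\<omega>. blinfun_apply (u \<omega>) x)"
proof -
  interpret prob_space M by fact
  have "AE \<omega> in M. norm (blinfun_apply (u \<omega>) x) \<le> Linf_norm M u * norm x"
    using AE_norm_le_Linf_norm[OF u]
    by eventually_elim (rule order_trans[OF norm_blinfun mult_right_mono], simp_all)
  moreover have "(\<lambda>\<omega>. blinfun_apply (u \<omega>) x) \<in> borel_measurable M"
    using u strongly_measurable_into_apply_measurable by (auto simp: Linf_fun_def)
  ultimately have "integrable M (\<lambda>\<omega>. blinfun_apply (u \<omega>) x)"
    by (rule integrable_const_bound)
  then show ?thesis
    unfolding set_integrable_def using A by (rule integrable_mult_indicator[rotated])
qed

lemma norm_mean_apply_le:
  assumes "prob_space M" and u: "u \<in> Linf_fun smul M" and A: "A \<in> sets M" "0 < measure M A"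
  shows "norm (mean_apply M A x u) \<le> norm x * Linf_norm M u"
proof -
  have "AE \<omega>\<in>A in M. norm (blinfun_apply (u \<omega>) x - 0) \<le> norm x * Linf_norm M u"
    using AE_norm_le_Linf_norm[OF u]
  proof eventually_elim
    case (elim \<omega>)
    then have "norm (blinfun_apply (u \<omega>) x) \<le> Linf_norm M u * norm x"
      by (rule order_trans[OF norm_blinfun mult_right_mono]) simp
    then show ?case by (simp add: mult.commute)
  qed
  from norm_set_average_diff_le[OF Linf_fun_apply_set_integrable[OF assms(1) u A(1)] A this]
  show ?thesis by (simp add: mean_apply_def)
qed

lemma norm_mean_apply_diff_le:
  assumes "prob_space M" and g: "g \<in> Linf_fun smul M" and h: "h \<in> Linf_fun smul M"
    and A: "A \<in> sets M" "0 < measure M A"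
    and le: "\<And>\<omega>. \<omega> \<in> A \<Longrightarrow> norm (blinfun_apply (g \<omega>) x - blinfun_apply (h \<omega>) x - c) \<le> r"
  shows "norm (mean_apply M A x g - mean_apply M A x h - c) \<le> r"
proof -
  note int = Linf_fun_apply_set_integrable[OF assms(1) g A(1), of x]
    Linf_fun_apply_set_integrable[OF assms(1) h A(1), of x]
  have "AE \<omega>\<in>A in M. norm (blinfun_apply (g \<omega>) x - blinfun_apply (h \<omega>) x - c) \<le> r"
    using le by simp
  from norm_set_average_diff_le[OF set_integral_diff(1)[OF int] A this]
  show ?thesis
    by (simp add: mean_apply_def set_integral_diff(2)[OF int] scaleR_diff_right)
qed

lemma mean_apply_cong:
  assumes "A \<in> sets M" and "\<And>\<omega>. \<omega> \<in> A \<Longrightarrow> u \<omega> = v \<omega>"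
  shows "mean_apply M A x u = mean_apply M A x v"
proof -
  have "(LINT \<omega>:A|M. blinfun_apply (u \<omega>) x) = (LINT \<omega>:A|M. blinfun_apply (v \<omega>) x)"
    using assms by (intro set_lebesgue_integral_cong) auto
  then show ?thesis by (simp add: mean_apply_def)
qed

lemma class_mean_apply_functional:
  fixes M :: "'w measure" and smul :: "'k::real_or_complex \<Rightarrow> 'x::banach \<Rightarrow> 'x"
  assumes M: "prob_space M" and A: "A \<in> sets M" "0 < measure M A"
  shows "class_mean_apply M A x \<in> Linf_functionals smul M"
proof -
  note int = Linf_fun_apply_set_integrable[OF M _ A(1), of _ smul x]
  have "mean_apply M A x (\<lambda>\<omega>. g \<omega> + h \<omega>) = mean_apply M A x g + mean_apply M A x h"
    if "g \<in> Linf_fun smul M" "h \<in> Linf_fun smul M" for g h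
    using int[OF that(1)] int[OF that(2)]
    by (simp add: mean_apply_def blinfun.add_left scaleR_add_right)
  moreover have "mean_apply M A x (\<lambda>\<omega>. dual_scale c (g \<omega>)) = c * mean_apply M A x g"
    for c and g :: "'w \<Rightarrow> 'x \<Rightarrow>\<^sub>L 'k"
    by (simp add: mean_apply_def)
  ultimately show ?thesis
    using norm_mean_apply_le[OF M _ A, of _ smul x]
    by (auto simp: Linf_functionals_def class_mean_apply_Linf_class Linf_fun_add Linf_fun_dual_scale A
        intro!: exI[of _ "norm x"])
qed

lemma pointwise_limit_functional:
  assumes U: "U \<noteq> bot"
    and \<phi>: "\<And>i. \<phi> i \<in> Linf_functionals smul M"
    and bound: "\<And>i g. g \<in> Linf_fun smul M \<Longrightarrow>
      norm (\<phi> i (Linf_class smul M g)) \<le> C * Linf_norm M g"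
    and lim: "\<And>g. g \<in> Linf_fun smul M \<Longrightarrow>
      ((\<lambda>i. \<phi> i (Linf_class smul M g)) \<longlongrightarrow> \<Phi> (Linf_class smul M g)) U"
  shows "\<Phi> \<in> Linf_functionals smul M"
proof -
  have "\<Phi> (Linf_class smul M (\<lambda>\<omega>. g \<omega> + h \<omega>)) = \<Phi> (Linf_class smul M g) + \<Phi> (Linf_class smul M h)"
    if g: "g \<in> Linf_fun smul M" and h: "h \<in> Linf_fun smul M" for g h
  proof (rule tendsto_unique[OF U lim[OF Linf_fun_add[OF g h]]])
    show "((\<lambda>i. \<phi> i (Linf_class smul M (\<lambda>\<omega>. g \<omega> + h \<omega>))) \<longlongrightarrow>
        \<Phi> (Linf_class smul M g) + \<Phi> (Linf_class smul M h)) U"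
      using tendsto_add[OF lim[OF g] lim[OF h]] \<phi> g h by (simp add: Linf_functionals_def)
  qed
  moreover have "\<Phi> (Linf_class smul M (\<lambda>\<omega>. dual_scale c (g \<omega>))) = c * \<Phi> (Linf_class smul M g)"
    if g: "g \<in> Linf_fun smul M" for c g
  proof (rule tendsto_unique[OF U lim[OF Linf_fun_dual_scale[OF g]]])
    show "((\<lambda>i. \<phi> i (Linf_class smul M (\<lambda>\<omega>. dual_scale c (g \<omega>)))) \<longlongrightarrow>
        c * \<Phi> (Linf_class smul M g)) U"
      using tendsto_mult_left[OF lim[OF g], of c] \<phi> g by (simp add: Linf_functionals_def)
  qed
  moreover have "norm (\<Phi> (Linf_class smul M g)) \<le> C * Linf_norm M g"
    if g: "g \<in> Linf_fun smul M" for g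
    by (rule Lim_norm_ubound[OF U lim[OF g]]) (simp add: bound[OF g])
  ultimately show ?thesis
    unfolding Linf_functionals_def by blast
qed

section \<open>Where two essentially bounded functions differ\<close>

text \<open>
  The values of a strongly measurable function are approximated by countably many vectors \<open>y\<close>, the
  values of the simple functions converging to it. Each \<open>y \<noteq> 0\<close> has an \<open>X y\<close> at which it attains
  more than half its norm, so where \<open>k \<omega>\<close> is within \<open>norm y / 4\<close> of \<open>y\<close>, the scalar \<open>k \<omega> (X y)\<close> is
  within half of \<open>norm (y (X y))\<close> of \<open>y (X y)\<close>. As \<open>k\<close> is close in this sense to one of the \<open>y\<close>
  wherever it does not vanish, some \<open>y\<close> works on a set that is not null.
\<close>

lemma exists_concentrated_values:
  fixes k :: "'w \<Rightarrow> 'x::real_normed_vector \<Rightarrow>\<^sub>L 'k::real_normed_vector"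
  assumes k: "strongly_measurable_into E M k" and nonzero: "\<not> (AE \<omega> in M. k \<omega> = 0)"
  shows "\<exists>x c. c \<noteq> 0 \<and> \<not> (AE \<omega> in M. \<not> norm (blinfun_apply (k \<omega>) x - c) \<le> norm c / 2)"
proof (rule ccontr)
  assume "\<not> ?thesis"
  then have ae: "AE \<omega> in M. \<not> norm (blinfun_apply (k \<omega>) x - c) \<le> norm c / 2" if "c \<noteq> 0" for x c
    using that by blast
  obtain s where s: "\<And>i::nat. simple_function M (s i)"
      "\<And>\<omega>. \<omega> \<in> space M \<Longrightarrow> (\<lambda>i. s i \<omega>) \<longlonglongrightarrow> k \<omega>"
    using k unfolding strongly_measurable_into_def by blast
  have "\<exists>x. norm y / 2 * norm x < norm (blinfun_apply y x)" if "y \<noteq> 0" for y :: "'x \<Rightarrow>\<^sub>L 'k"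
  proof (rule ccontr)
    assume "\<not> ?thesis"
    then have "norm y \<le> norm y / 2"
      by (intro norm_blinfun_bound) (auto simp: not_less)
    with that show False by simp
  qed
  then have "\<forall>y :: 'x \<Rightarrow>\<^sub>L 'k. \<exists>x. y \<noteq> 0 \<longrightarrow> norm y / 2 * norm x < norm (blinfun_apply y x)"
    by blast
  from choice[OF this] obtain X
    where X: "\<And>y :: 'x \<Rightarrow>\<^sub>L 'k. y \<noteq> 0 \<Longrightarrow> norm y / 2 * norm (X y) < norm (blinfun_apply y (X y))"
    by blast
  define T where "T = (\<Union>i. s i ` space M) - {0}"
  have "countable T"
    unfolding T_def using s(1)
    by (intro countable_Diff countable_UN) (auto simp: simple_function_def countable_finite)
  moreover have "AE \<omega> in M. \<not> norm (blinfun_apply (k \<omega>) (X y) - blinfun_apply y (X y))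
      \<le> norm (blinfun_apply y (X y)) / 2" if "y \<in> T" for y
  proof (rule ae)
    have "0 < norm (blinfun_apply y (X y))"
      using X[of y] that by (intro le_less_trans[OF _ X]) (auto simp: T_def)
    then show "blinfun_apply y (X y) \<noteq> 0" by simp
  qed
  ultimately have "AE \<omega> in M. \<forall>y\<in>T. \<not> norm (blinfun_apply (k \<omega>) (X y) - blinfun_apply y (X y))
      \<le> norm (blinfun_apply y (X y)) / 2"
    by (simp add: AE_ball_countable)
  then have "AE \<omega> in M. k \<omega> = 0"
    using AE_space
  proof eventually_elim
    case (elim \<omega>)
    show ?case
    proof (rule ccontr)
      assume "k \<omega> \<noteq> 0"
      \<comment> \<open>Close approximations of a nonzero value are close relative to their own norm.\<close>
      have "(\<lambda>i. 4 * norm (k \<omega> - s i \<omega>) - norm (s i \<omega>)) \<longlonglongrightarrow> 4 * norm (k \<omega> - k \<omega>) - norm (k \<omega>)"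
        by (intro tendsto_intros s(2) elim)
      then have "eventually (\<lambda>i. 4 * norm (k \<omega> - s i \<omega>) - norm (s i \<omega>) < 0) sequentially"
        by (rule order_tendstoD) (use \<open>k \<omega> \<noteq> 0\<close> in simp)
      then obtain i where i: "4 * norm (k \<omega> - s i \<omega>) < norm (s i \<omega>)"
        by (auto simp: eventually_sequentially)
      define y where "y = s i \<omega>"
      have "y \<noteq> 0" using i by (auto simp: y_def)
      then have "y \<in> T" using elim by (auto simp: T_def y_def)
      have "norm (blinfun_apply (k \<omega>) (X y) - blinfun_apply y (X y)) \<le> norm (k \<omega> - y) * norm (X y)"
        by (metis blinfun.diff_left norm_blinfun)
      also have "\<dots> \<le> norm y / 4 * norm (X y)"
        using i by (intro mult_right_mono) (auto simp: y_def)
      also have "\<dots> \<le> norm (blinfun_apply y (X y)) / 2"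
        using X[OF \<open>y \<noteq> 0\<close>] by simp
      finally show False using elim \<open>y \<in> T\<close> by blast
    qed
  qed
  with nonzero show False ..
qed

lemma non_atomic_decreasing_sequence:
  assumes "non_atomic M" and A: "A \<in> sets M" "0 < emeasure M A"
  obtains D :: "nat \<Rightarrow> 'w set" where "D 0 = A" "\<And>n. D n \<in> sets M" "decseq D"
    "\<And>n. 0 < emeasure M (D n - D (Suc n))"
proof -
  have "\<exists>D :: nat \<Rightarrow> 'w set. \<forall>n. ((D n \<in> sets M \<and> 0 < emeasure M (D n)) \<and> (n = 0 \<longrightarrow> D n = A)) \<and>
      (D (Suc n) \<subseteq> D n \<and> emeasure M (D (Suc n)) < emeasure M (D n))"
    using assms by (intro dependent_nat_choice) (auto simp: non_atomic_def)
  then obtain D where D: "\<And>n. D n \<in> sets M" "D 0 = A" "\<And>n. D (Suc n) \<subseteq> D n"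
      "\<And>n. emeasure M (D (Suc n)) < emeasure M (D n)"
    by blast
  have "0 < emeasure M (D n - D (Suc n))" for n
    using D(4)[of n] D(1,3)
    by (subst emeasure_Diff) (auto simp: diff_gr0_ennreal)
  then show thesis
    using that[of D] D decseq_SucI[of D] by blast
qed

section \<open>Norming functions\<close>

text \<open>
  The equality case of the Cauchy-Schwarz inequality. The inner product with 1 plays the part of the
  real part, which treats both scalar fields at once.
\<close>

lemma eq_of_real_if_norm_le_inner_one:
  fixes z :: "'k::real_or_complex"
  assumes "norm z \<le> r" and "z \<bullet> 1 = r"
  shows "z = of_real r"
proof -
  have "(norm (z - r *\<^sub>R 1))\<^sup>2 = (norm z)\<^sup>2 - r\<^sup>2"
    using dot_norm_neg[of z "r *\<^sub>R 1"] assms(2) by (simp add: power2_eq_square)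
  also have "\<dots> \<le> 0"
    using assms(1) by (simp add: power_mono)
  finally show ?thesis by (simp add: of_real_def)
qed

text \<open>
  The pointwise bound by \<open>norm (f \<omega>)\<close> has the same integral as the inner product of \<open>g \<omega> (f \<omega>)\<close>
  with 1, so their nonnegative difference vanishes almost everywhere.
\<close>

lemma S_tilde_AE_attains_norm:
  fixes smul :: "'k::real_or_complex \<Rightarrow> 'x::banach \<Rightarrow> 'x"
  assumes f: "f \<in> L1_sphere M" and g: "g \<in> Linf_fun smul M" "Linf_norm M g \<le> 1"
    and one: "(\<integral>\<omega>. blinfun_apply (g \<omega>) (f \<omega>) \<partial>M) = 1"
  shows "AE \<omega> in M. blinfun_apply (g \<omega>) (f \<omega>) = of_real (norm (f \<omega>))"
proof -
  \<comment> \<open>Integrals of functions that are not integrable are 0, so the values 1 entail integrability.\<close>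
  have int_f: "integrable M (\<lambda>\<omega>. norm (f \<omega>))" and f_one: "(\<integral>\<omega>. norm (f \<omega>) \<partial>M) = 1"
    using f not_integrable_integral_eq[of M "\<lambda>\<omega>. norm (f \<omega>)"] by (auto simp: L1_sphere_def)
  have int_g: "integrable M (\<lambda>\<omega>. blinfun_apply (g \<omega>) (f \<omega>))"
    using one not_integrable_integral_eq by fastforce
  have le: "AE \<omega> in M. norm (blinfun_apply (g \<omega>) (f \<omega>)) \<le> norm (f \<omega>)"
    using AE_norm_le_Linf_norm[OF g(1)]
  proof eventually_elim
    case (elim \<omega>)
    have "norm (blinfun_apply (g \<omega>) (f \<omega>)) \<le> norm (g \<omega>) * norm (f \<omega>)"
      by (rule norm_blinfun)
    also have "\<dots> \<le> 1 * norm (f \<omega>)"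
      using elim g(2) by (intro mult_right_mono) auto
    finally show ?case by simp
  qed
  have inner_one_le: "z \<bullet> 1 \<le> norm z" for z :: 'k
    using norm_cauchy_schwarz[of z 1] by simp
  have "(\<integral>\<omega>. norm (f \<omega>) - blinfun_apply (g \<omega>) (f \<omega>) \<bullet> 1 \<partial>M) = 0"
    using int_f int_g one f_one by (simp add: dot_square_norm)
  moreover have "AE \<omega> in M. 0 \<le> norm (f \<omega>) - blinfun_apply (g \<omega>) (f \<omega>) \<bullet> 1"
    using le by eventually_elim (smt (verit) inner_one_le)
  moreover have "integrable M (\<lambda>\<omega>. norm (f \<omega>) - blinfun_apply (g \<omega>) (f \<omega>) \<bullet> 1)"
    using int_f int_g by simp
  ultimately have "AE \<omega> in M. norm (f \<omega>) - blinfun_apply (g \<omega>) (f \<omega>) \<bullet> 1 = 0"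
    using integral_nonneg_eq_0_iff_AE by blast
  with le show ?thesis
  proof eventually_elim
    case (elim \<omega>)
    then show ?case by (intro eq_of_real_if_norm_le_inner_one) auto
  qed
qed

lemma S_tilde_glue:
  fixes smul :: "'k::real_or_complex \<Rightarrow> 'x::banach \<Rightarrow> 'x"
  assumes f: "f \<in> L1_sphere M" and B: "B \<in> sets M"
    and g: "g \<in> Linf_fun smul M" "Linf_norm M g \<le> 1" "(\<integral>\<omega>. blinfun_apply (g \<omega>) (f \<omega>) \<partial>M) = 1"
    and h: "h \<in> Linf_fun smul M" "Linf_norm M h \<le> 1" "(\<integral>\<omega>. blinfun_apply (h \<omega>) (f \<omega>) \<partial>M) = 1"
  defines "u \<equiv> \<lambda>\<omega>. if \<omega> \<in> B then g \<omega> else h \<omega>"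
  shows "u \<in> Linf_fun smul M" and "Linf_class smul M u \<in> S_tilde smul M f"
proof -
  have meas: "strongly_measurable_into (dual_space smul) M u"
    unfolding u_def using g(1) h(1) B
    by (intro strongly_measurable_into_If) (auto simp: Linf_fun_def)
  have le: "AE \<omega> in M. norm (u \<omega>) \<le> 1"
    using AE_norm_le_Linf_norm[OF g(1)] AE_norm_le_Linf_norm[OF h(1)]
    by eventually_elim (use g(2) h(2) in \<open>auto simp: u_def\<close>)
  show u: "u \<in> Linf_fun smul M"
    using meas le by (auto simp: Linf_fun_iff_AE_bounded)
  have int: "integrable M (\<lambda>\<omega>. blinfun_apply (g \<omega>) (f \<omega>))" "integrable M (\<lambda>\<omega>. blinfun_apply (h \<omega>) (f \<omega>))"
    using g(3) h(3) not_integrable_integral_eq by fastforce+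
  note [measurable] = int[THEN borel_measurable_integrable] B
  have "AE \<omega> in M. blinfun_apply (u \<omega>) (f \<omega>) = blinfun_apply (h \<omega>) (f \<omega>)"
    using S_tilde_AE_attains_norm[OF f g] S_tilde_AE_attains_norm[OF f h]
    by eventually_elim (simp add: u_def)
  moreover have "(\<lambda>\<omega>. blinfun_apply (u \<omega>) (f \<omega>)) =
      (\<lambda>\<omega>. if \<omega> \<in> B then blinfun_apply (g \<omega>) (f \<omega>) else blinfun_apply (h \<omega>) (f \<omega>))"
    by (auto simp: u_def)
  then have "(\<lambda>\<omega>. blinfun_apply (u \<omega>) (f \<omega>)) \<in> borel_measurable M"
    by simp
  ultimately have "(\<integral>\<omega>. blinfun_apply (u \<omega>) (f \<omega>) \<partial>M) = 1"
    using h(3) by (subst integral_cong_AE[where g = "\<lambda>\<omega>. blinfun_apply (h \<omega>) (f \<omega>)"]) auto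
  with u Linf_norm_le[OF meas le] show "Linf_class smul M u \<in> S_tilde smul M f"
    by (auto simp: S_tilde_def)
qed

section \<open>Weak compactness forces uniqueness\<close>

text \<open>
  The open cover described at the beginning: the averages over the pieces \<open>R i\<close> tell a
  member apart from \<open>g\<close> unless they all agree with those of \<open>g\<close>, in which case the
  limit functional tells it apart from \<open>h\<close>.
\<close>

lemma not_compactin_if_two_norming:
  fixes M :: "'w measure" and smul :: "'k::real_or_complex \<Rightarrow> 'x::banach \<Rightarrow> 'x"
  assumes M: "prob_space M" and "non_atomic M" and f: "f \<in> L1_sphere M"
    and g: "g \<in> Linf_fun smul M" "Linf_norm M g \<le> 1" "(\<integral>\<omega>. blinfun_apply (g \<omega>) (f \<omega>) \<partial>M) = 1"
    and h: "h \<in> Linf_fun smul M" "Linf_norm M h \<le> 1" "(\<integral>\<omega>. blinfun_apply (h \<omega>) (f \<omega>) \<partial>M) = 1"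
    and differ: "\<not> (AE \<omega> in M. g \<omega> = h \<omega>)"
  shows "\<not> compactin (Linf_weak_topology smul M) (S_tilde smul M f)"
proof
  interpret prob_space M by fact
  let ?cl = "Linf_class smul M"
  have diff_meas: "strongly_measurable_into UNIV M (\<lambda>\<omega>. g \<omega> - h \<omega>)"
  proof (rule strongly_measurable_into_map2[where F = "(-)"])
    show "strongly_measurable_into (dual_space smul) M g" "strongly_measurable_into (dual_space smul) M h"
      using g h by (simp_all add: Linf_fun_def)
    show "continuous_on UNIV (\<lambda>(u::'x \<Rightarrow>\<^sub>L 'k, v). u - v)"
      unfolding split_def by (intro continuous_intros)
  qed simp
  obtain x c where "c \<noteq> 0"
    and conc: "\<not> (AE \<omega> in M. \<not> norm (blinfun_apply (g \<omega> - h \<omega>) x - c) \<le> norm c / 2)"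
    using exists_concentrated_values[OF diff_meas] differ by auto
  define A where "A = {\<omega>\<in>space M. norm (blinfun_apply (g \<omega> - h \<omega>) x - c) \<le> norm c / 2}"
  have [measurable]: "(\<lambda>\<omega>. blinfun_apply (g \<omega> - h \<omega>) x) \<in> borel_measurable M"
    using diff_meas by (rule strongly_measurable_into_apply_measurable)
  have A: "A \<in> sets M" unfolding A_def by measurable
  have "0 < emeasure M A"
    using conc A unfolding A_def by (subst (asm) AE_iff_measurable[OF _ refl]) (auto simp: zero_less_iff_neq_zero)
  then obtain D :: "nat \<Rightarrow> 'w set"
    where D: "D 0 = A" "\<And>n. D n \<in> sets M" "decseq D" "\<And>n. 0 < emeasure M (D n - D (Suc n))"
    using non_atomic_decreasing_sequence[OF \<open>non_atomic M\<close> A] by metis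
  \<comment> \<open>From index \<open>n\<close> on, the pieces lie inside \<open>D n\<close>, before it they are disjoint from \<open>D n\<close>.\<close>
  define R where "R i = D i - D (Suc i)" for i
  have R: "R i \<in> sets M" "0 < measure M (R i)" for i
    using D(2) D(4)[of i] by (auto simp: R_def emeasure_eq_measure)
  have R_subset: "R i \<subseteq> A" for i
    using decseqD[OF D(3), of 0 i] D(1) by (auto simp: R_def)
  define u where "u n = (\<lambda>\<omega>. if \<omega> \<in> D n then h \<omega> else g \<omega>)" for n
  have u: "u n \<in> Linf_fun smul M" "?cl (u n) \<in> S_tilde smul M f" for n
    unfolding u_def using S_tilde_glue[OF f D(2) h g] by auto

  define \<phi> :: "nat \<Rightarrow> ('w \<Rightarrow> 'x \<Rightarrow>\<^sub>L 'k) set \<Rightarrow> 'k"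
    where "\<phi> i = class_mean_apply M (R i) x" for i
  have \<phi>_class: "\<phi> i (?cl v) = mean_apply M (R i) x v" if "v \<in> Linf_fun smul M" for i v
    unfolding \<phi>_def using that R(1) by (rule class_mean_apply_Linf_class)
  have \<phi>: "\<phi> i \<in> Linf_functionals smul M" for i
    unfolding \<phi>_def using M R by (rule class_mean_apply_functional)
  have \<phi>_le: "norm (\<phi> i (?cl v)) \<le> norm x * Linf_norm M v" if "v \<in> Linf_fun smul M" for i v
    using norm_mean_apply_le[OF M that R] by (simp add: \<phi>_class that)
  have \<phi>_diff: "norm (\<phi> i (?cl g) - \<phi> i (?cl h) - c) \<le> norm c / 2" for i
    unfolding \<phi>_class[OF g(1)] \<phi>_class[OF h(1)]
  proof (rule norm_mean_apply_diff_le[OF M g(1) h(1) R])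
    fix \<omega> assume "\<omega> \<in> R i"
    then have "\<omega> \<in> A" using R_subset by blast
    then show "norm (blinfun_apply (g \<omega>) x - blinfun_apply (h \<omega>) x - c) \<le> norm c / 2"
      by (simp add: A_def blinfun.diff_left)
  qed
  have \<phi>_u_g: "\<phi> i (?cl (u n)) = \<phi> i (?cl g)" if "i < n" for i n
  proof -
    have "\<omega> \<notin> D n" if "\<omega> \<in> R i" for \<omega>
      using decseqD[OF D(3), of "Suc i" n] \<open>i < n\<close> that by (auto simp: R_def)
    then show ?thesis
      by (simp add: \<phi>_class g u) (intro mean_apply_cong R, simp add: u_def)
  qed
  have \<phi>_u_h: "\<phi> i (?cl (u n)) = \<phi> i (?cl h)" if "n \<le> i" for i n
  proof -
    have "\<omega> \<in> D n" if "\<omega> \<in> R i" for \<omega>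
      using decseqD[OF D(3), of n i] \<open>n \<le> i\<close> that by (auto simp: R_def)
    then show ?thesis
      by (simp add: \<phi>_class h u) (intro mean_apply_cong R, simp add: u_def)
  qed

  obtain U where U: "U \<noteq> bot" "U \<le> sequentially"
    and U_lim: "\<And>s :: nat \<Rightarrow> 'k. bounded (range s) \<Longrightarrow> \<exists>l. (s \<longlongrightarrow> l) U"
    using exists_free_ultralimit by blast
  define \<Phi> where "\<Phi> G = Lim U (\<lambda>i. \<phi> i G)" for G
  have lim: "((\<lambda>i. \<phi> i (?cl v)) \<longlongrightarrow> \<Phi> (?cl v)) U" if "v \<in> Linf_fun smul M" for v
  proof -
    have "bounded (range (\<lambda>i. \<phi> i (?cl v)))"
      using \<phi>_le[OF that] by (auto simp: bounded_iff)
    then obtain l where "((\<lambda>i. \<phi> i (?cl v)) \<longlongrightarrow> l) U"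
      using U_lim by blast
    then show ?thesis
      using tendsto_Lim[OF U(1)] by (auto simp: \<Phi>_def)
  qed
  have \<Phi>: "\<Phi> \<in> Linf_functionals smul M"
    using U(1) \<phi> \<phi>_le lim by (rule pointwise_limit_functional)
  have \<Phi>_u: "\<Phi> (?cl (u n)) = \<Phi> (?cl h)" for n
  proof (rule tendsto_unique[OF U(1) lim[OF u(1)]])
    have "eventually (\<lambda>i. \<phi> i (?cl h) = \<phi> i (?cl (u n))) sequentially"
      by (rule eventually_sequentiallyI[of n]) (simp add: \<phi>_u_h)
    then have "eventually (\<lambda>i. \<phi> i (?cl h) = \<phi> i (?cl (u n))) U"
      by (rule filter_leD[OF U(2)])
    then show "((\<lambda>i. \<phi> i (?cl (u n))) \<longlongrightarrow> \<Phi> (?cl h)) U"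
      using lim[OF h(1)] by (rule Lim_transform_eventually[rotated])
  qed
  have "norm (\<Phi> (?cl g) - \<Phi> (?cl h) - c) \<le> norm c / 2"
    by (rule Lim_norm_ubound[OF U(1) tendsto_diff[OF tendsto_diff[OF lim[OF g(1)] lim[OF h(1)]] tendsto_const]])
      (rule always_eventually, rule allI, rule \<phi>_diff)
  then have \<Phi>_neq: "\<Phi> (?cl g) \<noteq> \<Phi> (?cl h)"
    using \<open>c \<noteq> 0\<close> by auto

  define V where "V = {G \<in> Linf smul M. \<Phi> G \<in> - {\<Phi> (?cl h)}}"
  define W where "W i = {G \<in> Linf smul M. \<phi> i G \<in> - {\<phi> i (?cl g)}}" for i
  have V_open: "openin (Linf_weak_topology smul M) V"
    unfolding Linf_weak_topology_def V_def using \<Phi>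
    by (intro topology_generated_by_Basis) blast
  have W_open: "openin (Linf_weak_topology smul M) (W i)" for i
    unfolding Linf_weak_topology_def W_def using \<phi>
    by (intro topology_generated_by_Basis) blast
  have cover: "S_tilde smul M f \<subseteq> \<Union>(insert V (range W))"
  proof
    fix G assume "G \<in> S_tilde smul M f"
    then obtain v where v: "v \<in> Linf_fun smul M" and G: "G = ?cl v"
      by (auto simp: S_tilde_def)
    have "G \<in> Linf smul M"
      unfolding G Linf_def using v by (rule quotientI)
    show "G \<in> \<Union>(insert V (range W))"
    proof (cases "\<exists>i. \<phi> i G \<noteq> \<phi> i (?cl g)")
      case True
      then show ?thesis using \<open>G \<in> Linf smul M\<close> by (auto simp: W_def)
    next
      case False
      then have "\<Phi> G = \<Phi> (?cl g)" by (simp add: \<Phi>_def)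
      then show ?thesis using \<open>G \<in> Linf smul M\<close> \<Phi>_neq by (simp add: V_def)
    qed
  qed
  assume "compactin (Linf_weak_topology smul M) (S_tilde smul M f)"
  then have "(\<forall>Y\<in>insert V (range W). openin (Linf_weak_topology smul M) Y) \<and>
      S_tilde smul M f \<subseteq> \<Union>(insert V (range W)) \<longrightarrow>
    (\<exists>\<F>. finite \<F> \<and> \<F> \<subseteq> insert V (range W) \<and> S_tilde smul M f \<subseteq> \<Union>\<F>)"
    unfolding compactin_def by (elim conjE allE)
  moreover have "\<forall>Y\<in>insert V (range W). openin (Linf_weak_topology smul M) Y"
    using V_open W_open by auto
  ultimately obtain \<F> where \<F>: "finite \<F>" "\<F> \<subseteq> insert V (range W)" "S_tilde smul M f \<subseteq> \<Union>\<F>"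
    using cover by (elim impE exE conjE) simp_all
  have "finite (\<F> - {V})" "\<F> - {V} \<subseteq> range W" using \<F>(1,2) by auto
  from finite_subset_image[OF this] obtain I where I: "finite I" "\<F> - {V} = W ` I"
    by blast
  obtain n where n: "\<And>i. i \<in> I \<Longrightarrow> i < n"
    using iffD1[OF finite_nat_set_iff_bounded I(1)] by blast
  have "?cl (u n) \<notin> V"
    by (simp add: V_def \<Phi>_u)
  moreover have "?cl (u n) \<notin> W i" if "i \<in> I" for i
    using \<phi>_u_g[OF n[OF that]] by (simp add: W_def)
  ultimately have "?cl (u n) \<notin> \<Union>\<F>"
    using I(2) by auto
  with u(2)[of n] \<F>(3) show False by blast
qed

theorem theorem3p6:
  fixes M :: "'w measure"
    and smul :: "'k::real_or_complex \<Rightarrow> 'x::banach \<Rightarrow> 'x"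
    and f :: "'w \<Rightarrow> 'x"
  assumes "prob_space M" and "non_atomic M"
    and "banach_over smul"
    and "f \<in> L1_sphere M"
    and "S_tilde smul M f \<noteq> {}"
    and "compactin (Linf_weak_topology smul M) (S_tilde smul M f)"
  shows "is_singleton (S_tilde smul M f)"
proof (rule is_singletonI')
  show "S_tilde smul M f \<noteq> {}" by fact
  fix G H assume "G \<in> S_tilde smul M f" "H \<in> S_tilde smul M f"
  then obtain g h where G: "G = Linf_class smul M g" and H: "H = Linf_class smul M h"
    and g: "g \<in> Linf_fun smul M" "Linf_norm M g \<le> 1" "(\<integral>\<omega>. blinfun_apply (g \<omega>) (f \<omega>) \<partial>M) = 1"
    and h: "h \<in> Linf_fun smul M" "Linf_norm M h \<le> 1" "(\<integral>\<omega>. blinfun_apply (h \<omega>) (f \<omega>) \<partial>M) = 1"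
    by (auto simp: S_tilde_def)
  have "AE \<omega> in M. g \<omega> = h \<omega>"
    using not_compactin_if_two_norming[OF assms(1,2,4) g h] assms(6) by blast
  then show "G = H"
    by (simp add: G H Linf_class_eq_iff g h)
qed

end
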